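(* Let $A:\hat\Sigma_{\mathbf M}\to\mathbb R$ be Lipschitz continuous. Suppose that $\beta_n\to\infty$ and that $\phi_{\beta_n}/\beta_n\to V$ uniformly. Fix a point $\mathbf y\in\Sigma^*_{\mathbf M}$ and let $\mu_{\mathbf y,\beta_n}$ be the effective probability for $\beta_nA$ at $\mathbf y$. Then any weak* accumulation point $\mu^\infty_{\mathbf y}\in\mathcal M_\sigma$ of the sequence $(\mu_{\mathbf y,\beta_n})_n$ is a maximizing probability for $A(\mathbf y,\cdot)+V$, that is, $$\int\big(A(\mathbf y,\cdot)+V\big)\,d\mu^\infty_{\mathbf y}=\max_{\mu\in\mathcal M_\sigma}\int\big(A(\mathbf y,\cdot)+V\big)\,d\mu .$$
   Context: Let $\mathbf M:\{1,\dots,r\}\times\{1,\dots,r\}\to\{0,1\}$ be an irreducible symmetric transition matrix. Let $\Sigma_{\mathbf M}=\{(x_0,x_1,\dots)\in\{1,\dots,r\}^{\mathbb Z_+}:\mathbf M(x_j,x_{j+1})=1\ \forall j\}$, with left shift $\sigma(x_0,x_1,x_2,\dots)=(x_1,x_2,\dots)$, and let $\Sigma^*_{\mathbf M}$ be the dual subshift of sequences $(\dots,x_1,x_0)$ with $\mathbf M(x_{j+1},x_j)=1$ for all $j$. As $\mathbf M$ is symmetric, $\mathbf x=(x_0,x_1,\dots)\mapsto\mathbf x^*=(\dots,x_1,x_0)$ is a bijection $\Sigma_{\mathbf M}\to\Sigma^*_{\mathbf M}$, by which the two spaces, and functions on them, are identified (points $\mathbf y^*$ are written simply $\mathbf y$).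 Fix $\Lambda\in(0,1)$; for $\mathbf x\neq\mathbf y$ put $d(\mathbf x,\mathbf y)=\Lambda^k$ with $k=\min\{j:x_j\neq y_j\}$ (and $d(\mathbf x,\mathbf x)=0$). $\mathcal H$ is the space of Lipschitz continuous real functions on $\Sigma_{\mathbf M}\simeq\Sigma^*_{\mathbf M}$. Let $\hat\Sigma_{\mathbf M}=\{(\mathbf y,\mathbf x)\in\Sigma^*_{\mathbf M}\times\Sigma_{\mathbf M}:\mathbf M(y_0,x_0)=1\}$ with the product (max) metric. In every expression where $\mathbf y$ is fixed and $\mathbf x$ ranges over all of $\Sigma_{\mathbf M}$, $A(\mathbf y,\mathbf x)$ means $A(\mathbf y,\mathbf x)\mathbf M(y_0,x_0)$, i.e. $A$ is extended by $0$. Let $\mathcal M_\sigma$ be the set of $\sigma$-invariant Borel probability measures on $\Sigma_{\mathbf M}$ and $h_\mu(\sigma)$ the Kolmogorov–Sinai entropy. For $\beta>0$ and $\phi\in\mathcal H$ put $$\mathcal G_\beta(\phi)(\mathbf y)=\sup_{\mu\in\mathcal M_\sigma}\Big[\int_{\Sigma_{\mathbf M}}\big(\beta A(\mathbf y,\mathbf x)+\phi(\mathbf x)\big)\,d\mu(\mathbf x)+h_\mu(\sigma)\Big].$$ There is a function $\phi_\beta\in\mathcal H$, unique up to an additive constant, and a unique $\lambda_\beta\in\mathbb R$ with $\mathcal G_\beta(\phi_\beta)=\phi_\beta+\lambda_\beta$; $\phi_\beta$ is the effective potential and $\lambda_\beta$ the effective constant for $\beta A$. A point $\mathbf y^0\in\Sigma^*_{\mathbf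 M}$ is fixed once and for all and $\phi_\beta$ is normalized by $\phi_\beta(\mathbf y^0)=0$ for all $\beta$. For each $\mathbf y$, the effective probability $\mu_{\mathbf y,\beta}\in\mathcal M_\sigma$ for $\beta A$ at $\mathbf y$ is the unique measure attaining the supremum defining $\mathcal G_\beta(\phi_\beta)(\mathbf y)$. *)

theory Defs
  imports "HOL-Probability.Probability"
begin

section \<open>Transition matrices and subshifts\<close>

type_synonym seq = "nat \<Rightarrow> nat"

fun mat_power :: "nat \<Rightarrow> (nat \<Rightarrow> nat \<Rightarrow> nat) \<Rightarrow> nat \<Rightarrow> nat \<Rightarrow> nat \<Rightarrow> nat" where
  "mat_power r M 0 i j = (if i = j then 1 else 0)"
| "mat_power r M (Suc n) i j = (\<Sum>k=1..r. mat_power r M n i k * M k j)"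

definition irreducible_matrix :: "nat \<Rightarrow> (nat \<Rightarrow> nat \<Rightarrow> nat) \<Rightarrow> bool" where
  "irreducible_matrix r M \<longleftrightarrow> (\<forall>i\<in>{1..r}. \<forall>j\<in>{1..r}. \<exists>n\<ge>1. mat_power r M n i j > 0)"

definition symmetric_matrix :: "nat \<Rightarrow> (nat \<Rightarrow> nat \<Rightarrow> nat) \<Rightarrow> bool" where
  "symmetric_matrix r M \<longleftrightarrow> (\<forall>i\<in>{1..r}. \<forall>j\<in>{1..r}. M i j = M j i)"

definition transition_matrix :: "nat \<Rightarrow> (nat \<Rightarrow> nat \<Rightarrow> nat) \<Rightarrow> bool" where
  "transition_matrix r M \<longleftrightarrow> r \<ge> 1 \<and> (\<forall>i\<in>{1..r}. \<forall>j\<in>{1..r}. M i j \<in> {0, 1})"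

definition shift_space :: "nat \<Rightarrow> (nat \<Rightarrow> nat \<Rightarrow> nat) \<Rightarrow> seq set" where
  "shift_space r M = {x. \<forall>j. x j \<in> {1..r} \<and> M (x j) (x (Suc j)) = 1}"

text \<open>A point \<open>(\<dots>, y\<^sub>1, y\<^sub>0)\<close> of the dual subshift is represented by the function
  \<open>j \<mapsto> y\<^sub>j\<close>. In this representation the bijection \<open>x \<mapsto> x\<^sup>*\<close> is the identity,
  so functions on the two spaces need no conversion.\<close>

definition dual_shift_space :: "nat \<Rightarrow> (nat \<Rightarrow> nat \<Rightarrow> nat) \<Rightarrow> seq set" where
  "dual_shift_space r M = {y. \<forall>j. y j \<in> {1..r} \<and> M (y (Suc j)) (y j) = 1}"

lemma dual_shift_space_eq:
  assumes "symmetric_matrix r M"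
  shows "dual_shift_space r M = shift_space r M"
proof (intro set_eqI)
  fix x
  show "x \<in> dual_shift_space r M \<longleftrightarrow> x \<in> shift_space r M"
  proof (cases "\<forall>j. x j \<in> {1..r}")
    case True
    then have "M (x (Suc j)) (x j) = 1 \<longleftrightarrow> M (x j) (x (Suc j)) = 1" for j
      using assms unfolding symmetric_matrix_def by (metis (no_types))
    then show ?thesis
      by (simp only: dual_shift_space_def shift_space_def mem_Collect_eq)
  next
    case False
    then show ?thesis
      by (simp only: dual_shift_space_def shift_space_def mem_Collect_eq) blast
  qed
qed

definition shift :: "seq \<Rightarrow> seq" where
  "shift x = (\<lambda>j. x (Suc j))"

definition seq_dist :: "real \<Rightarrow> seq \<Rightarrow> seq \<Rightarrow> real" where
  "seq_dist \<Lambda> x y = (if x = y then 0 else \<Lambda> ^ (LEAST j. x j \<noteq> y j))"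

lemma Metric_space_seq_dist:
  assumes "0 < \<Lambda>" "\<Lambda> < 1"
  shows "Metric_space S (seq_dist \<Lambda>)"
proof
  fix x y z :: seq
  show nonneg: "0 \<le> seq_dist \<Lambda> x y" for x y
    using assms by (simp add: seq_dist_def)
  have "(x = y) = (y = x)" and "(x j \<noteq> y j) = (y j \<noteq> x j)" for j
    by (rule eq_commute, rule arg_cong[of _ _ Not], rule eq_commute)
  then show "seq_dist \<Lambda> x y = seq_dist \<Lambda> y x"
    unfolding seq_dist_def by presburger
  show "(seq_dist \<Lambda> x y = 0) = (x = y)"
    using assms by (simp add: seq_dist_def)
  show "seq_dist \<Lambda> x z \<le> seq_dist \<Lambda> x y + seq_dist \<Lambda> y z"
  proof (cases "x = y \<or> y = z \<or> x = z")
    case True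
    then show ?thesis
      using nonneg[of x y] nonneg[of y z] by (elim disjE) (simp_all add: seq_dist_def)
  next
    case False
    define k where "k = (LEAST j. x j \<noteq> z j)"
    have "\<exists>j. x j \<noteq> z j"
      using False by (meson ext)
    then have "x k \<noteq> z k"
      unfolding k_def by (rule LeastI_ex[of "\<lambda>j. x j \<noteq> z j"])
    then consider "x k \<noteq> y k" | "y k \<noteq> z k" by force
    then show ?thesis
    proof cases
      case 1
      then have "(LEAST j. x j \<noteq> y j) \<le> k" by (rule Least_le)
      then have "\<Lambda> ^ k \<le> \<Lambda> ^ (LEAST j. x j \<noteq> y j)"
        using assms by (intro power_decreasing) auto
      then have "seq_dist \<Lambda> x z \<le> seq_dist \<Lambda> x y"
        using False by (simp add: seq_dist_def k_def)
      then show ?thesis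
        using nonneg[of y z] by linarith
    next
      case 2
      then have "(LEAST j. y j \<noteq> z j) \<le> k" by (rule Least_le)
      then have "\<Lambda> ^ k \<le> \<Lambda> ^ (LEAST j. y j \<noteq> z j)"
        using assms by (intro power_decreasing) auto
      then have "seq_dist \<Lambda> x z \<le> seq_dist \<Lambda> y z"
        using False by (simp add: seq_dist_def k_def)
      then show ?thesis
        using nonneg[of x y] by linarith
    qed
  qed
qed

definition shift_metric :: "nat \<Rightarrow> (nat \<Rightarrow> nat \<Rightarrow> nat) \<Rightarrow> real \<Rightarrow> seq metric" where
  "shift_metric r M \<Lambda> = metric (shift_space r M, seq_dist \<Lambda>)"

lemma shift_metric_simps:
  assumes "0 < \<Lambda>" "\<Lambda> < 1"
  shows "mspace (shift_metric r M \<Lambda>) = shift_space r M"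
    and "mdist (shift_metric r M \<Lambda>) = seq_dist \<Lambda>"
  using Metric_space.mspace_metric[OF Metric_space_seq_dist[OF assms]]
    Metric_space.mdist_metric[OF Metric_space_seq_dist[OF assms]]
  by (simp_all add: shift_metric_def)

definition joint_shift_space :: "nat \<Rightarrow> (nat \<Rightarrow> nat \<Rightarrow> nat) \<Rightarrow> (seq \<times> seq) set" where
  "joint_shift_space r M =
     {(y, x). y \<in> dual_shift_space r M \<and> x \<in> shift_space r M \<and> M (y 0) (x 0) = 1}"

definition max_dist :: "real \<Rightarrow> seq \<times> seq \<Rightarrow> seq \<times> seq \<Rightarrow> real" where
  "max_dist \<Lambda> p q = max (seq_dist \<Lambda> (fst p) (fst q)) (seq_dist \<Lambda> (snd p) (snd q))"

lemma Metric_space_max_dist: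
  assumes "0 < \<Lambda>" "\<Lambda> < 1"
  shows "Metric_space S (max_dist \<Lambda>)"
proof -
  interpret d: Metric_space UNIV "seq_dist \<Lambda>"
    by (rule Metric_space_seq_dist[OF assms])
  show ?thesis
  proof
    fix p q u :: "seq \<times> seq"
    show "0 \<le> max_dist \<Lambda> p q"
      unfolding max_dist_def by (intro max.coboundedI1 d.nonneg)
    show "max_dist \<Lambda> p q = max_dist \<Lambda> q p"
      unfolding max_dist_def by (simp only: d.commute)
    have "max_dist \<Lambda> p q = 0 \<longleftrightarrow>
        seq_dist \<Lambda> (fst p) (fst q) = 0 \<and> seq_dist \<Lambda> (snd p) (snd q) = 0"
      using d.nonneg[of "fst p" "fst q"] d.nonneg[of "snd p" "snd q"]
      unfolding max_dist_def max_def by (simp only: split: if_split) linarith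
    then show "(max_dist \<Lambda> p q = 0) = (p = q)"
      by (simp only: d.zero UNIV_I prod_eq_iff)
    have "seq_dist \<Lambda> (fst p) (fst u) \<le> max_dist \<Lambda> p q + max_dist \<Lambda> q u"
      unfolding max_dist_def
      by (rule order.trans[OF d.triangle[of _ "fst q"] add_mono]) simp_all
    moreover have "seq_dist \<Lambda> (snd p) (snd u) \<le> max_dist \<Lambda> p q + max_dist \<Lambda> q u"
      unfolding max_dist_def
      by (rule order.trans[OF d.triangle[of _ "snd q"] add_mono]) simp_all
    ultimately show "max_dist \<Lambda> p u \<le> max_dist \<Lambda> p q + max_dist \<Lambda> q u"
      by (simp only: max_dist_def[of \<Lambda> p u] max.bounded_iff)
  qed
qed

definition joint_shift_metric ::
    "nat \<Rightarrow> (nat \<Rightarrow> nat \<Rightarrow> nat) \<Rightarrow> real \<Rightarrow> (seq \<times> seq) metric" where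
  "joint_shift_metric r M \<Lambda> = metric (joint_shift_space r M, max_dist \<Lambda>)"

lemma joint_shift_metric_simps:
  assumes "0 < \<Lambda>" "\<Lambda> < 1"
  shows "mspace (joint_shift_metric r M \<Lambda>) = joint_shift_space r M"
    and "mdist (joint_shift_metric r M \<Lambda>) = max_dist \<Lambda>"
  using Metric_space.mspace_metric[OF Metric_space_max_dist[OF assms]]
    Metric_space.mdist_metric[OF Metric_space_max_dist[OF assms]]
  by (simp_all add: joint_shift_metric_def)

text \<open>Only the values of such functions on the subshift matter; nothing is required of
  their values elsewhere on the type.\<close>

definition lipschitz_functions ::
    "nat \<Rightarrow> (nat \<Rightarrow> nat \<Rightarrow> nat) \<Rightarrow> real \<Rightarrow> (seq \<Rightarrow> real) set" where
  "lipschitz_functions r M \<Lambda> =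
     {\<phi>. Lipschitz_continuous_map (shift_metric r M \<Lambda>) euclidean_metric \<phi>}"

definition zero_extension ::
    "(nat \<Rightarrow> nat \<Rightarrow> nat) \<Rightarrow> (seq \<times> seq \<Rightarrow> real) \<Rightarrow> seq \<Rightarrow> seq \<Rightarrow> real" where
  "zero_extension M A y x = A (y, x) * real (M (y 0) (x 0))"


section \<open>Kolmogorov--Sinai entropy\<close>

definition partition_entropy :: "'a measure \<Rightarrow> 'a set set \<Rightarrow> real" where
  "partition_entropy \<mu> P = - (\<Sum>B\<in>P. measure \<mu> B * ln (measure \<mu> B))"

text \<open>The join of \<open>P, T\<^sup>-\<^sup>1 P, \<dots>, T\<^sup>-\<^sup>(\<^sup>n\<^sup>-\<^sup>1\<^sup>) P\<close>. Empty cells of the preimage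
  partitions are harmless, since \<^const>\<open>common_refinement\<close> discards the empty set.\<close>

definition iterated_join :: "'a measure \<Rightarrow> ('a \<Rightarrow> 'a) \<Rightarrow> 'a set set \<Rightarrow> nat \<Rightarrow> 'a set set" where
  "iterated_join \<mu> T P n =
     common_refinement ((\<lambda>k. (\<lambda>B. (T ^^ k) -` B \<inter> space \<mu>) ` P) ` {..<n})"

definition entropy_of_partition :: "'a measure \<Rightarrow> ('a \<Rightarrow> 'a) \<Rightarrow> 'a set set \<Rightarrow> real" where
  "entropy_of_partition \<mu> T P =
     lim (\<lambda>n. partition_entropy \<mu> (iterated_join \<mu> T P n) / real n)"

definition KS_entropy :: "'a measure \<Rightarrow> ('a \<Rightarrow> 'a) \<Rightarrow> ereal" where
  "KS_entropy \<mu> T =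
     (SUP P\<in>{P. finite P \<and> P \<subseteq> sets \<mu> \<and> partition_on (space \<mu>) P}.
        ereal (entropy_of_partition \<mu> T P))"


section \<open>Invariant probabilities and the weak* topology\<close>

definition shift_borel :: "nat \<Rightarrow> (nat \<Rightarrow> nat \<Rightarrow> nat) \<Rightarrow> real \<Rightarrow> seq measure" where
  "shift_borel r M \<Lambda> =
     sigma (shift_space r M) {U. openin (mtopology_of (shift_metric r M \<Lambda>)) U}"

definition invariant_probabilities ::
    "nat \<Rightarrow> (nat \<Rightarrow> nat \<Rightarrow> nat) \<Rightarrow> real \<Rightarrow> seq measure set" where
  "invariant_probabilities r M \<Lambda> =
     {\<mu>. prob_space \<mu> \<and> sets \<mu> = sets (shift_borel r M \<Lambda>) \<and>
         shift \<in> measurable \<mu> \<mu> \<and> distr \<mu> \<mu> shift = \<mu>}"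

text \<open>The coarsest topology on the invariant probabilities for which
  \<open>\<mu> \<mapsto> \<integral> f d\<mu>\<close> is continuous for every continuous \<open>f\<close>.\<close>

definition weak_star_topology ::
    "nat \<Rightarrow> (nat \<Rightarrow> nat \<Rightarrow> nat) \<Rightarrow> real \<Rightarrow> seq measure topology" where
  "weak_star_topology r M \<Lambda> = topology_generated_by
     {{\<mu> \<in> invariant_probabilities r M \<Lambda>. (\<integral>x. f x \<partial>\<mu>) \<in> U} | f U.
        continuous_map (mtopology_of (shift_metric r M \<Lambda>)) euclideanreal f \<and> open U}"

lemma topspace_weak_star_topology:
  "topspace (weak_star_topology r M \<Lambda>) = invariant_probabilities r M \<Lambda>"
proof -
  have "continuous_map (mtopology_of (shift_metric r M \<Lambda>)) euclideanreal (\<lambda>_. 0)"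
    by simp
  then have "invariant_probabilities r M \<Lambda> \<in>
      {{\<mu> \<in> invariant_probabilities r M \<Lambda>. (\<integral>x. f x \<partial>\<mu>) \<in> U} | f U.
        continuous_map (mtopology_of (shift_metric r M \<Lambda>)) euclideanreal f \<and> open U}"
      (is "_ \<in> ?S")
    by (intro CollectI exI[of _ "\<lambda>_. 0"] exI[of _ UNIV] conjI) simp_all
  moreover have "B \<subseteq> invariant_probabilities r M \<Lambda>" if "B \<in> ?S" for B
    using that by blast
  ultimately have "\<Union> ?S = invariant_probabilities r M \<Lambda>"
    by (meson Sup_least Sup_upper subset_antisym)
  then show ?thesis
    unfolding weak_star_topology_def topology_generated_by_topspace .
qed

definition accumulation_point :: "'a topology \<Rightarrow> (nat \<Rightarrow> 'a) \<Rightarrow> 'a \<Rightarrow> bool" where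
  "accumulation_point X s a \<longleftrightarrow> a \<in> topspace X \<and>
     (\<forall>U. openin X U \<and> a \<in> U \<longrightarrow> (\<exists>\<^sub>F n in sequentially. s n \<in> U))"

definition maximizing_probability ::
    "nat \<Rightarrow> (nat \<Rightarrow> nat \<Rightarrow> nat) \<Rightarrow> real \<Rightarrow> (seq \<Rightarrow> real) \<Rightarrow> seq measure \<Rightarrow> bool" where
  "maximizing_probability r M \<Lambda> f \<mu> \<longleftrightarrow> \<mu> \<in> invariant_probabilities r M \<Lambda> \<and>
     (\<forall>\<nu>\<in>invariant_probabilities r M \<Lambda>. (\<integral>x. f x \<partial>\<nu>) \<le> (\<integral>x. f x \<partial>\<mu>))"


section \<open>Effective potential, constant and probabilities\<close>

definition free_energy :: "(nat \<Rightarrow> nat \<Rightarrow> nat) \<Rightarrow> (seq \<times> seq \<Rightarrow> real) \<Rightarrow> real \<Rightarrow>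
    (seq \<Rightarrow> real) \<Rightarrow> seq \<Rightarrow> seq measure \<Rightarrow> ereal" where
  "free_energy M A \<beta> \<phi> y \<mu> =
     ereal (\<integral>x. (\<beta> * zero_extension M A y x + \<phi> x) \<partial>\<mu>) + KS_entropy \<mu> shift"

definition effective_operator :: "nat \<Rightarrow> (nat \<Rightarrow> nat \<Rightarrow> nat) \<Rightarrow> real \<Rightarrow>
    (seq \<times> seq \<Rightarrow> real) \<Rightarrow> real \<Rightarrow> (seq \<Rightarrow> real) \<Rightarrow> seq \<Rightarrow> ereal" where
  "effective_operator r M \<Lambda> A \<beta> \<phi> y =
     (SUP \<mu>\<in>invariant_probabilities r M \<Lambda>. free_energy M A \<beta> \<phi> y \<mu>)"

text \<open>The additive normalization at the base point \<open>y\<^sup>0\<close> makes \<open>\<phi>\<close> unique on the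
  subshift.\<close>

definition effective_potential :: "nat \<Rightarrow> (nat \<Rightarrow> nat \<Rightarrow> nat) \<Rightarrow> real \<Rightarrow>
    (seq \<times> seq \<Rightarrow> real) \<Rightarrow> seq \<Rightarrow> real \<Rightarrow> (seq \<Rightarrow> real) \<Rightarrow> real \<Rightarrow> bool" where
  "effective_potential r M \<Lambda> A y\<^sub>0 \<beta> \<phi> lam \<longleftrightarrow>
     \<phi> \<in> lipschitz_functions r M \<Lambda> \<and> \<phi> y\<^sub>0 = 0 \<and>
     (\<forall>y\<in>dual_shift_space r M. effective_operator r M \<Lambda> A \<beta> \<phi> y = ereal (\<phi> y + lam))"

definition effective_probability :: "nat \<Rightarrow> (nat \<Rightarrow> nat \<Rightarrow> nat) \<Rightarrow> real \<Rightarrow>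
    (seq \<times> seq \<Rightarrow> real) \<Rightarrow> real \<Rightarrow> (seq \<Rightarrow> real) \<Rightarrow> seq \<Rightarrow> seq measure \<Rightarrow> bool" where
  "effective_probability r M \<Lambda> A \<beta> \<phi> y \<mu> \<longleftrightarrow>
     \<mu> \<in> invariant_probabilities r M \<Lambda> \<and>
     free_energy M A \<beta> \<phi> y \<mu> = effective_operator r M \<Lambda> A \<beta> \<phi> y"

end

theory Submission
  imports Defs
begin

text \<open>
  Dividing the variational problem by \<open>\<beta>\<^sub>n\<close> suppresses the entropy term as soon as the entropy is
  bounded uniformly over all invariant probabilities.
  Indeed, let \<open>0 \<le> h\<^sub>\<nu> \<le> C\<close> for every \<open>\<nu>\<close>.  Since \<open>\<mu>\<^sub>n\<close> attains the supremum,
  every invariant \<open>\<nu>\<close> satisfies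
  \<open>\<integral> (\<beta>\<^sub>n A + \<phi>\<^sub>n) d\<nu> \<le> \<integral> (\<beta>\<^sub>n A + \<phi>\<^sub>n) d\<mu>\<^sub>n + C\<close>; after division by \<open>\<beta>\<^sub>n\<close> and uniform
  replacement of \<open>\<phi>\<^sub>n / \<beta>\<^sub>n\<close> by \<open>V\<close> the error tends to \<open>0\<close>.  As \<open>A(y, \<cdot>) + V\<close> is continuous,
  \<open>\<integral> (A(y, \<cdot>) + V) d\<mu>\<^sub>n\<close> comes arbitrarily close to the integral against an accumulation point
  for infinitely many \<open>n\<close>, and the inequality passes to that point.

  The lower entropy bound comes from the one-cell partition (\<open>KS_entropy_nonneg\<close>).  The upper bound
  is usually \<open>ln r\<close>, via the theorem on generating partitions.  It is obtained here from
  the variational problem itself (\<open>KS_entropy_bounded_if_effective_operator_finite\<close>): at inverse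
  temperature \<open>1\<close> the supremum of energy plus entropy is a real number, and the energy is
  bounded, so the entropies are bounded.
\<close>

section \<open>Bounded entropy\<close>

lemma iterated_join_trivial_partition:
  assumes "T \<in> measurable \<mu> \<mu>" and "space \<mu> \<noteq> {}" and "n > 0"
  shows "iterated_join \<mu> T {space \<mu>} n = {space \<mu>}"
proof -
  have "(T ^^ k) x \<in> space \<mu>" if "x \<in> space \<mu>" for k x
    using that measurable_space[OF assms(1)] by (induction k) auto
  then have "(T ^^ k) -` space \<mu> \<inter> space \<mu> = space \<mu>" for k
    by auto
  then have "(\<lambda>k. (\<lambda>B. (T ^^ k) -` B \<inter> space \<mu>) ` {space \<mu>}) ` {..<n} = {{space \<mu>}}"
    using \<open>n > 0\<close> by (auto simp: image_def)
  moreover have "common_refinement {{space \<mu>}} = {space \<mu>}"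
    using assms(2) by (auto simp: common_refinement)
  ultimately show ?thesis
    by (simp add: iterated_join_def)
qed

lemma KS_entropy_nonneg:
  assumes "prob_space \<mu>" and "T \<in> measurable \<mu> \<mu>"
  shows "0 \<le> KS_entropy \<mu> T"
proof -
  interpret prob_space \<mu> by fact
  have "eventually (\<lambda>n. partition_entropy \<mu> (iterated_join \<mu> T {space \<mu>} n) / real n = 0) sequentially"
    using eventually_gt_at_top[of 0]
    by eventually_elim
      (simp add: iterated_join_trivial_partition[OF assms(2) not_empty] partition_entropy_def prob_space)
  then have "(\<lambda>n. partition_entropy \<mu> (iterated_join \<mu> T {space \<mu>} n) / real n) \<longlonglongrightarrow> 0"
    by (rule tendsto_eventually)
  then have "entropy_of_partition \<mu> T {space \<mu>} = 0"
    unfolding entropy_of_partition_def by (rule limI)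
  moreover have "{space \<mu>} \<in> {P. finite P \<and> P \<subseteq> sets \<mu> \<and> partition_on (space \<mu>) P}"
    using not_empty by (auto simp: partition_on_def)
  ultimately show ?thesis
    unfolding KS_entropy_def by (metis (no_types, lifting) SUP_upper zero_ereal_def)
qed

text \<open>
  No single \<open>\<nu>\<close> can have more entropy than the gap between the supremum and its own
  energy; this gap is at most \<open>c + K\<close>, a constant that does not see \<open>\<nu>\<close>.
\<close>

lemma KS_entropy_bounded_if_effective_operator_finite:
  assumes fin: "effective_operator r M \<Lambda> A \<beta> \<phi> y = ereal c"
    and bound: "\<And>\<nu>. \<nu> \<in> invariant_probabilities r M \<Lambda> \<Longrightarrow>
      \<bar>\<integral>x. (\<beta> * zero_extension M A y x + \<phi> x) \<partial>\<nu>\<bar> \<le> K"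
    and "\<nu> \<in> invariant_probabilities r M \<Lambda>"
  shows "KS_entropy \<nu> shift \<le> ereal (c + K)"
proof -
  have "free_energy M A \<beta> \<phi> y \<nu> \<le> ereal c"
    unfolding fin[symmetric] effective_operator_def using assms(3) by (rule SUP_upper)
  then show ?thesis
    using bound[OF assms(3)] unfolding free_energy_def
    by (cases "KS_entropy \<nu> shift") auto
qed

text \<open>
  A maximizer of energy plus entropy can only fall short of the maximal energy by what it gains
  in entropy, and the range of the entropy is contained in \<open>[0, C]\<close>.
\<close>

lemma effective_probability_energy_le:
  assumes "effective_probability r M \<Lambda> A \<beta> \<phi> y \<mu>"
    and \<nu>: "\<nu> \<in> invariant_probabilities r M \<Lambda>"
    and le: "\<And>\<nu>. \<nu> \<in> invariant_probabilities r M \<Lambda> \<Longrightarrow> KS_entropy \<nu> shift \<le> ereal C"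
  shows "(\<integral>x. (\<beta> * zero_extension M A y x + \<phi> x) \<partial>\<nu>) \<le>
    (\<integral>x. (\<beta> * zero_extension M A y x + \<phi> x) \<partial>\<mu>) + C"
proof -
  have \<mu>: "\<mu> \<in> invariant_probabilities r M \<Lambda>"
    and eq: "free_energy M A \<beta> \<phi> y \<mu> = effective_operator r M \<Lambda> A \<beta> \<phi> y"
    using assms(1) by (auto simp: effective_probability_def)
  have "free_energy M A \<beta> \<phi> y \<nu> \<le> free_energy M A \<beta> \<phi> y \<mu>"
    unfolding eq effective_operator_def using \<nu> by (rule SUP_upper)
  moreover have "0 \<le> KS_entropy \<nu> shift"
    using \<nu> by (intro KS_entropy_nonneg) (auto simp: invariant_probabilities_def)
  ultimately show ?thesis
    using le[OF \<mu>] unfolding free_energy_def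
    by (cases "KS_entropy \<nu> shift"; cases "KS_entropy \<mu> shift") auto
qed

section \<open>Observables on the subshift\<close>

lemma integrable_invariant_probability:
  assumes \<nu>: "\<nu> \<in> invariant_probabilities r M \<Lambda>"
    and "0 < \<Lambda>" "\<Lambda> < 1"
    and cont: "continuous_map (mtopology_of (shift_metric r M \<Lambda>)) euclideanreal f"
    and bound: "\<And>x. x \<in> shift_space r M \<Longrightarrow> \<bar>f x\<bar> \<le> K"
  shows "integrable \<nu> f" and "\<bar>\<integral>x. f x \<partial>\<nu>\<bar> \<le> K"
proof -
  interpret prob_space \<nu>
    using \<nu> by (simp add: invariant_probabilities_def)
  let ?X = "mtopology_of (shift_metric r M \<Lambda>)"
  have top: "topspace ?X = shift_space r M"
    by (simp add: shift_metric_simps[OF assms(2,3)])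
  have sub: "{U. openin ?X U} \<subseteq> Pow (shift_space r M)"
    using openin_subset[of ?X] unfolding top by blast
  have sets: "sets \<nu> = sets (shift_borel r M \<Lambda>)"
    using \<nu> by (simp add: invariant_probabilities_def)
  have space: "space \<nu> = shift_space r M"
    using sets_eq_imp_space_eq[OF sets] by (simp add: shift_borel_def space_measure_of[OF sub])
  have meas: "f \<in> borel_measurable \<nu>"
  proof (rule borel_measurableI)
    fix S :: "real set" assume "open S"
    then have "openin ?X {x \<in> topspace ?X. f x \<in> S}"
      using cont by (intro openin_continuous_map_preimage[of _ euclidean]) auto
    moreover have "{x \<in> topspace ?X. f x \<in> S} = f -` S \<inter> space \<nu>"
      using top space by auto
    ultimately show "f -` S \<inter> space \<nu> \<in> sets \<nu>"
      unfolding sets by (simp add: shift_borel_def sets_measure_of[OF sub])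
  qed
  have AE: "AE x in \<nu>. norm (f x) \<le> K"
    using bound space by (intro AE_I2) auto
  show int: "integrable \<nu> f"
    by (rule integrable_const_bound[OF AE meas])
  have "f x \<le> K" "- K \<le> f x" if "x \<in> space \<nu>" for x
    using bound[of x] that space by auto
  then have "(\<integral>x. f x \<partial>\<nu>) \<le> K" "- K \<le> (\<integral>x. f x \<partial>\<nu>)"
    by (intro integral_le_const[OF int] integral_ge_const[OF int] AE_I2; simp)+
  then show "\<bar>\<integral>x. f x \<partial>\<nu>\<bar> \<le> K"
    by linarith
qed

lemma integral_uniformly_close:
  assumes "\<nu> \<in> invariant_probabilities r M \<Lambda>" "0 < \<Lambda>" "\<Lambda> < 1"
    and f: "continuous_map (mtopology_of (shift_metric r M \<Lambda>)) euclideanreal f"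
      "\<And>x. x \<in> shift_space r M \<Longrightarrow> \<bar>f x\<bar> \<le> K"
    and g: "continuous_map (mtopology_of (shift_metric r M \<Lambda>)) euclideanreal g"
      "\<And>x. x \<in> shift_space r M \<Longrightarrow> \<bar>g x\<bar> \<le> L"
    and close: "\<And>x. x \<in> shift_space r M \<Longrightarrow> \<bar>f x - g x\<bar> \<le> e"
  shows "\<bar>(\<integral>x. f x \<partial>\<nu>) - (\<integral>x. g x \<partial>\<nu>)\<bar> \<le> e"
proof -
  have "continuous_map (mtopology_of (shift_metric r M \<Lambda>)) euclideanreal (\<lambda>x. f x - g x)"
    using f(1) g(1) by (rule continuous_map_diff)
  then have "\<bar>\<integral>x. (f x - g x) \<partial>\<nu>\<bar> \<le> e"
    by (rule integrable_invariant_probability(2)[OF assms(1-3) _ close])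
  moreover have "integrable \<nu> f" "integrable \<nu> g"
    by (rule integrable_invariant_probability(1)[OF assms(1-3) f(1)], erule f(2),
        rule integrable_invariant_probability(1)[OF assms(1-3) g(1)], erule g(2))
  ultimately show ?thesis
    by simp
qed

lemma Lipschitz_bounded_if_dist_le_1:
  fixes f :: "'a \<Rightarrow> real"
  assumes "Lipschitz_continuous_map m euclidean_metric f"
    and diam: "\<And>x y. mdist m x y \<le> 1"
  obtains K where "K \<ge> 0" "\<And>x. x \<in> mspace m \<Longrightarrow> \<bar>f x\<bar> \<le> K"
proof (cases "mspace m = {}")
  case False
  then obtain a where a: "a \<in> mspace m" by blast
  obtain B where "B > 0"
    and B: "\<And>x y. \<lbrakk>x \<in> mspace m; y \<in> mspace m\<rbrakk> \<Longrightarrow> \<bar>f x - f y\<bar> \<le> B * mdist m x y"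
    using assms(1) unfolding Lipschitz_continuous_map_pos by (auto simp: dist_real_def)
  have "\<bar>f x\<bar> \<le> \<bar>f a\<bar> + B" if "x \<in> mspace m" for x
    using B[OF that a] mult_left_le[OF diam[of x a], of B] \<open>B > 0\<close> by linarith
  then show ?thesis
    using \<open>B > 0\<close> by (intro that[of "\<bar>f a\<bar> + B"]) auto
qed (use that[of 0] in auto)

lemma seq_dist_le_1:
  assumes "0 < \<Lambda>" "\<Lambda> < 1"
  shows "seq_dist \<Lambda> x y \<le> 1"
  using assms by (simp add: seq_dist_def power_le_one)

lemma seq_dist_eq_1:
  assumes "x 0 \<noteq> y 0"
  shows "seq_dist \<Lambda> x y = 1"
proof -
  have "(LEAST j. x j \<noteq> y j) = 0"
    using assms by (intro Least_equality) auto
  then show ?thesis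
    using assms by (auto simp: seq_dist_def)
qed

lemma lipschitz_functionsE:
  assumes "f \<in> lipschitz_functions r M \<Lambda>" "0 < \<Lambda>" "\<Lambda> < 1"
  obtains K where "continuous_map (mtopology_of (shift_metric r M \<Lambda>)) euclideanreal f"
    and "\<And>x. x \<in> shift_space r M \<Longrightarrow> \<bar>f x\<bar> \<le> K"
proof -
  have lip: "Lipschitz_continuous_map (shift_metric r M \<Lambda>) euclidean_metric f"
    using assms(1) by (simp add: lipschitz_functions_def)
  then have "continuous_map (mtopology_of (shift_metric r M \<Lambda>)) euclideanreal f"
    using Lipschitz_continuous_imp_continuous_map by fastforce
  moreover have diam: "mdist (shift_metric r M \<Lambda>) x y \<le> 1" for x y
    by (simp add: shift_metric_simps(2)[OF assms(2,3)] seq_dist_le_1[OF assms(2,3)])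
  obtain K where "\<And>x. x \<in> shift_space r M \<Longrightarrow> \<bar>f x\<bar> \<le> K"
    using Lipschitz_bounded_if_dist_le_1[OF lip diam]
    unfolding shift_metric_simps(1)[OF assms(2,3)] by blast
  ultimately show ?thesis
    by (rule that)
qed

text \<open>
  Extending \<open>A(y, \<cdot>)\<close> by \<open>0\<close> creates no discontinuity, because membership in the support only depends on
  the first symbol and points with different first symbols lie at distance \<open>1\<close>: across such a
  jump, twice a bound for \<open>\<bar>A\<bar>\<close> serves as a Lipschitz constant.
\<close>

lemma zero_extension_lipschitz:
  assumes "transition_matrix r M" "0 < \<Lambda>" "\<Lambda> < 1"
    and A: "Lipschitz_continuous_map (joint_shift_metric r M \<Lambda>) euclidean_metric A"
    and y: "y \<in> dual_shift_space r M"
  shows "zero_extension M A y \<in> lipschitz_functions r M \<Lambda>"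
proof -
  note simps = joint_shift_metric_simps[OF assms(2,3)] shift_metric_simps[OF assms(2,3)]
  obtain K where "K \<ge> 0" and K: "\<And>p. p \<in> joint_shift_space r M \<Longrightarrow> \<bar>A p\<bar> \<le> K"
    using A by (rule Lipschitz_bounded_if_dist_le_1)
      (auto simp: simps max_dist_def seq_dist_le_1[OF assms(2,3)])
  obtain B where "B > 0" and B: "\<And>p q. \<lbrakk>p \<in> joint_shift_space r M; q \<in> joint_shift_space r M\<rbrakk> \<Longrightarrow>
      \<bar>A p - A q\<bar> \<le> B * max_dist \<Lambda> p q"
    using A unfolding Lipschitz_continuous_map_pos by (auto simp: simps dist_real_def)
  have M01: "M (y 0) (x 0) = 0 \<or> M (y 0) (x 0) = 1" if "x \<in> shift_space r M" for x
    using assms(1) y that unfolding transition_matrix_def dual_shift_space_def shift_space_def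
    by (simp only: mem_Collect_eq) blast
  have nonneg: "0 \<le> seq_dist \<Lambda> x x'" for x x'
    using assms(2) by (simp add: seq_dist_def)
  have bound: "\<bar>zero_extension M A y x\<bar> \<le> K" if "x \<in> shift_space r M" for x
    using M01[OF that] K[of "(y, x)"] y that \<open>K \<ge> 0\<close>
    by (auto simp: zero_extension_def joint_shift_space_def)
  have "\<bar>zero_extension M A y x - zero_extension M A y x'\<bar> \<le> (B + 2 * K) * seq_dist \<Lambda> x x'"
    if xx': "x \<in> shift_space r M" "x' \<in> shift_space r M" for x x'
  proof (cases "x 0 = x' 0")
    case False
    then show ?thesis
      using bound[OF xx'(1)] bound[OF xx'(2)] \<open>B > 0\<close> by (simp add: seq_dist_eq_1)
  next
    case True
    have "\<bar>zero_extension M A y x - zero_extension M A y x'\<bar> \<le> B * seq_dist \<Lambda> x x'"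
    proof (cases "M (y 0) (x 0) = 1")
      case True
      then show ?thesis
        using B[of "(y, x)" "(y, x')"] y xx' \<open>x 0 = x' 0\<close> nonneg[of x x']
        by (simp add: zero_extension_def joint_shift_space_def max_dist_def seq_dist_def[of _ y y])
    next
      case False
      then show ?thesis
        using M01[OF xx'(1)] \<open>x 0 = x' 0\<close> \<open>B > 0\<close> nonneg[of x x']
        by (simp add: zero_extension_def)
    qed
    also have "\<dots> \<le> (B + 2 * K) * seq_dist \<Lambda> x x'"
      using \<open>K \<ge> 0\<close> nonneg by (intro mult_right_mono) auto
    finally show ?thesis .
  qed
  then show ?thesis
    unfolding lipschitz_functions_def Lipschitz_continuous_map_def
    by (auto simp: simps dist_real_def)
qed

section \<open>Weak* accumulation points\<close>

lemma frequently_integral_close_accumulation_point: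
  assumes "accumulation_point (weak_star_topology r M \<Lambda>) \<mu> \<mu>_lim"
    and f: "continuous_map (mtopology_of (shift_metric r M \<Lambda>)) euclideanreal f"
    and "e > 0"
  shows "\<exists>\<^sub>F n in sequentially. \<bar>(\<integral>x. f x \<partial>\<mu> n) - (\<integral>x. f x \<partial>\<mu>_lim)\<bar> < e"
proof -
  define U where "U = {\<nu> \<in> invariant_probabilities r M \<Lambda>. (\<integral>x. f x \<partial>\<nu>) \<in> ball (\<integral>x. f x \<partial>\<mu>_lim) e}"
  have "openin (weak_star_topology r M \<Lambda>) U"
    unfolding weak_star_topology_def U_def
    by (rule topology_generated_by_Basis) (use f in blast)
  moreover have "\<mu>_lim \<in> U"
    using assms(1,3) by (simp add: U_def accumulation_point_def topspace_weak_star_topology)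
  ultimately have "\<exists>\<^sub>F n in sequentially. \<mu> n \<in> U"
    using assms(1) by (simp add: accumulation_point_def)
  then show ?thesis
    by (rule frequently_elim1) (auto simp: U_def dist_real_def)
qed

theorem proposition3:
  fixes r :: nat and M :: "nat \<Rightarrow> nat \<Rightarrow> nat" and \<Lambda> :: real
    and A :: "seq \<times> seq \<Rightarrow> real" and y\<^sub>0 y :: seq
    and \<phi> :: "real \<Rightarrow> seq \<Rightarrow> real" and lam :: "real \<Rightarrow> real"
    and \<beta> :: "nat \<Rightarrow> real" and V :: "seq \<Rightarrow> real"
    and \<mu> :: "nat \<Rightarrow> seq measure" and \<mu>_lim :: "seq measure"
  assumes "transition_matrix r M" "symmetric_matrix r M" "irreducible_matrix r M"
    and "0 < \<Lambda>" "\<Lambda> < 1"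
    and "Lipschitz_continuous_map (joint_shift_metric r M \<Lambda>) euclidean_metric A"
    and "y\<^sub>0 \<in> dual_shift_space r M"
    and "\<And>b. b > 0 \<Longrightarrow> effective_potential r M \<Lambda> A y\<^sub>0 b (\<phi> b) (lam b)"
    and "\<And>n. \<beta> n > 0" "filterlim \<beta> at_top sequentially"
    and "uniform_limit (shift_space r M) (\<lambda>n x. \<phi> (\<beta> n) x / \<beta> n) V sequentially"
    and "y \<in> dual_shift_space r M"
    and "\<And>n. effective_probability r M \<Lambda> A (\<beta> n) (\<phi> (\<beta> n)) y (\<mu> n)"
    and "accumulation_point (weak_star_topology r M \<Lambda>) \<mu> \<mu>_lim"
  shows "maximizing_probability r M \<Lambda> (\<lambda>x. zero_extension M A y x + V x) \<mu>_lim"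
proof -
  note \<Lambda> = \<open>0 < \<Lambda>\<close> \<open>\<Lambda> < 1\<close>
  let ?X = "mtopology_of (shift_metric r M \<Lambda>)"
  let ?inv = "invariant_probabilities r M \<Lambda>"
  define z where "z = zero_extension M A y"
  define g where "g n x = z x + \<phi> (\<beta> n) x / \<beta> n" for n x
  define F where "F x = z x + V x" for x

  have top: "topspace ?X = shift_space r M"
    by (simp add: shift_metric_simps[OF \<Lambda>])
  have "z \<in> lipschitz_functions r M \<Lambda>"
    unfolding z_def using assms(1,4,5,6,12) by (rule zero_extension_lipschitz)
  then obtain Kz where z: "continuous_map ?X euclideanreal z" "\<And>x. x \<in> shift_space r M \<Longrightarrow> \<bar>z x\<bar> \<le> Kz"
    using \<Lambda> by (rule lipschitz_functionsE) blast
  have \<phi>: "\<exists>K. continuous_map ?X euclideanreal (\<phi> b) \<and> (\<forall>x\<in>shift_space r M. \<bar>\<phi> b x\<bar> \<le> K)"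
    if "b > 0" for b
  proof -
    have "\<phi> b \<in> lipschitz_functions r M \<Lambda>"
      using assms(8)[OF that] by (simp add: effective_potential_def)
    then show ?thesis
      using \<Lambda> by (rule lipschitz_functionsE) blast
  qed
  then obtain K where cont_\<phi>: "\<And>b. b > 0 \<Longrightarrow> continuous_map ?X euclideanreal (\<phi> b)"
    and K: "\<And>b x. b > 0 \<Longrightarrow> x \<in> shift_space r M \<Longrightarrow> \<bar>\<phi> b x\<bar> \<le> K b"
    by metis

  have g_cont: "continuous_map ?X euclideanreal (g n)" for n
    unfolding g_def using z(1) cont_\<phi> \<open>\<And>n. \<beta> n > 0\<close>
    by (intro continuous_map_add continuous_map_real_divide) (auto simp: less_imp_neq[THEN not_sym])
  have g_bound: "\<bar>g n x\<bar> \<le> Kz + K (\<beta> n) / \<beta> n" if "x \<in> shift_space r M" for n x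
  proof -
    have "\<bar>\<phi> (\<beta> n) x / \<beta> n\<bar> \<le> K (\<beta> n) / \<beta> n"
      using K[OF \<open>\<beta> n > 0\<close> that] \<open>\<beta> n > 0\<close> by (simp add: abs_divide divide_right_mono)
    then show ?thesis
      using z(2)[OF that] unfolding g_def by linarith
  qed
  have unif: "\<forall>\<^sub>F n in sequentially. \<forall>x\<in>shift_space r M. \<bar>g n x - F x\<bar> < e" if "e > 0" for e
    using uniform_limitD[OF assms(11) that] by (simp add: g_def F_def dist_real_def)
  have F_cont: "continuous_map ?X euclideanreal F"
  proof -
    have "continuous_map ?X Met_TC.mtopology F"
    proof (rule Met_TC.continuous_map_uniform_limit[where F = sequentially and f = g])
      show "\<forall>\<^sub>F n in sequentially. \<forall>x\<in>topspace ?X. F x \<in> UNIV \<and> dist (g n x) (F x) < e"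
        if "e > 0" for e
        unfolding top dist_real_def using unif[OF that] by simp
    qed (use g_cont in simp_all)
    then show ?thesis by simp
  qed
  obtain m where "\<forall>x\<in>shift_space r M. \<bar>g m x - F x\<bar> < 1"
    using eventually_happens[OF unif[of 1]] by auto
  then have F_bound: "\<bar>F x\<bar> \<le> Kz + K (\<beta> m) / \<beta> m + 1" if "x \<in> shift_space r M" for x
    using g_bound[OF that, of m] that by fastforce

  \<comment> \<open>Any fixed inverse temperature would serve; the resulting \<open>C\<close> does not depend on \<open>n\<close>.\<close>
  obtain C where C: "\<And>\<nu>. \<nu> \<in> ?inv \<Longrightarrow> KS_entropy \<nu> shift \<le> ereal C"
  proof -
    have "effective_operator r M \<Lambda> A 1 (\<phi> 1) y = ereal (\<phi> 1 y + lam 1)"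
      using assms(8)[of 1] assms(12) by (simp add: effective_potential_def)
    moreover have "\<bar>\<integral>x. (1 * zero_extension M A y x + \<phi> 1 x) \<partial>\<nu>\<bar> \<le> Kz + K 1" if "\<nu> \<in> ?inv" for \<nu>
    proof (rule integrable_invariant_probability(2)[OF that \<Lambda>])
      show "continuous_map ?X euclideanreal (\<lambda>x. 1 * zero_extension M A y x + \<phi> 1 x)"
        using continuous_map_add[OF z(1) cont_\<phi>[of 1]] by (simp add: z_def)
      show "\<bar>1 * zero_extension M A y x + \<phi> 1 x\<bar> \<le> Kz + K 1" if "x \<in> shift_space r M" for x
        using z(2)[OF that] K[of 1 x] that unfolding z_def by force
    qed
    ultimately show ?thesis
      by (intro that) (rule KS_entropy_bounded_if_effective_operator_finite)
  qed
  have g_le: "(\<integral>x. g n x \<partial>\<nu>) \<le> (\<integral>x. g n x \<partial>\<mu> n) + C / \<beta> n" if "\<nu> \<in> ?inv" for n \<nu>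
  proof -
    have "\<beta> n * zero_extension M A y x + \<phi> (\<beta> n) x = \<beta> n * g n x" for x
      using \<open>\<beta> n > 0\<close> by (simp add: g_def z_def field_simps)
    then have "\<beta> n * (\<integral>x. g n x \<partial>\<nu>) \<le> \<beta> n * (\<integral>x. g n x \<partial>\<mu> n) + C"
      using effective_probability_energy_le[OF assms(13) that C, of n] by simp
    then show ?thesis
      using \<open>\<beta> n > 0\<close> by (simp add: field_simps)
  qed
  have "(\<integral>x. F x \<partial>\<nu>) \<le> (\<integral>x. F x \<partial>\<mu>_lim)" if \<nu>: "\<nu> \<in> ?inv" for \<nu>
  proof (rule field_le_epsilon)
    fix e :: real assume "e > 0"
    \<comment> \<open>Four errors of size \<open>e / 4\<close>: entropy, \<open>g n\<close> against \<open>F\<close> under \<open>\<nu>\<close> and under \<open>\<mu> n\<close>, and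
      \<open>\<mu> n\<close> against \<open>\<mu>_lim\<close>.\<close>
    then have "e / 4 > 0" by simp
    have "(\<lambda>n. C / \<beta> n) \<longlonglongrightarrow> 0"
      using tendsto_const assms(10) by (rule real_tendsto_divide_at_top)
    then have "\<forall>\<^sub>F n in sequentially. C / \<beta> n < e / 4"
      using \<open>e / 4 > 0\<close> by (rule order_tendstoD(2))
    then have ev: "\<forall>\<^sub>F n in sequentially. C / \<beta> n < e / 4 \<and> (\<forall>x\<in>shift_space r M. \<bar>g n x - F x\<bar> < e / 4)"
      using unif[OF \<open>e / 4 > 0\<close>] by (rule eventually_conj)
    obtain n where n: "C / \<beta> n < e / 4" "\<And>x. x \<in> shift_space r M \<Longrightarrow> \<bar>g n x - F x\<bar> \<le> e / 4"
      "\<bar>(\<integral>x. F x \<partial>\<mu> n) - (\<integral>x. F x \<partial>\<mu>_lim)\<bar> < e / 4"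
      using frequently_ex[OF frequently_eventually_frequently[OF
        frequently_integral_close_accumulation_point[OF assms(14) F_cont \<open>e / 4 > 0\<close>] ev]]
      by (blast intro: less_imp_le)
    have close: "\<bar>(\<integral>x. g n x \<partial>\<rho>) - (\<integral>x. F x \<partial>\<rho>)\<bar> \<le> e / 4" if "\<rho> \<in> ?inv" for \<rho>
      using that \<Lambda> g_cont g_bound F_cont F_bound n(2) by (rule integral_uniformly_close)
    have "\<mu> n \<in> ?inv"
      using assms(13) by (simp add: effective_probability_def)
    show "(\<integral>x. F x \<partial>\<nu>) \<le> (\<integral>x. F x \<partial>\<mu>_lim) + e"
      using g_le[OF \<nu>, of n] close[OF \<nu>] close[OF \<open>\<mu> n \<in> ?inv\<close>] n(1,3) by linarith
  qed
  moreover have "\<mu>_lim \<in> ?inv"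
    using assms(14) by (simp add: accumulation_point_def topspace_weak_star_topology)
  ultimately show ?thesis
    unfolding maximizing_probability_def by (simp add: F_def z_def)
qed

end
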